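(* Let $(K,v)$ be a valued field, let $(K(X)|K,w)$ be a value transcendental extension of $(K,v)$, and let $E=\{z_\nu\}_{\nu<\lambda}$ be a pseudo divergent sequence in $(K,v)$ diverging to infinity. Assume that $X$ is not a limit of $E$ (with respect to $w$). Then $w=v_E$.
   Context: Conventions. A valued field $(K,v)$ is a field with a (Krull) valuation, value group $vK$. Valuations with the same valuation ring are identified. $(K(X)|K,w)$ is value transcendental if $\dim_{\mathbb Q}\bigl(\mathbb Q\otimes_{\mathbb Z}(wK(X)/vK)\bigr)=1$. Let $\lambda$ be a limit ordinal. $E=\{z_\nu\}_{\nu<\lambda}\subseteq K$ is pseudo divergent (pds) if $v(z_{\nu_1}-z_{\nu_2})>v(z_{\nu_2}-z_{\nu_3})$ for all $\nu_1<\nu_2<\nu_3<\lambda$; put $\delta_\nu:=v(z_\nu-z_\mu)$ for any $\mu<\nu$ (independent of $\mu$; defined for $\nu\ge 1$). A pds $E$ diverges to infinity if $\{\delta_\nu\}_{\nu<\lambda}$ is coinitial in $vK$. An element $y$ of a valued extension field is a limit of $E$ if the value of $y-z_\nu$ is $\delta_\nu$ for all sufficiently large $\nu$. $v_E$ is the valuation of $K(X)$ with valuation ring $\{\phi\in K(X)\mid v\phi(z_\nu)\ge 0$ for all sufficiently large $\nu\}$ (maximal ideal given by $v\phi(z_\nu)>0$ for all sufficiently large $\nu$); it extends $v$. *)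

theory Defs
  imports
    "HOL-Library.Extended"
    "HOL-Computational_Algebra.Polynomial_Factorial"
    "HOL-Algebra.Free_Abelian_Groups"
    "Jordan_Normal_Form.VS_Connect"
begin

text \<open>Valuations are written additively, with values in an ordered abelian group \<open>'g\<close> extended by
  \<open>Pinf\<close>, the value of \<open>0\<close>. The group \<open>'g\<close> may be larger than the value group. The element \<open>Minf\<close>
  of the library type \<open>'g extended\<close> is excluded.\<close>

definition is_valuation :: "('a::field \<Rightarrow> 'g::linordered_ab_group_add extended) \<Rightarrow> bool" where
  "is_valuation v \<longleftrightarrow>
     (\<forall>x. v x \<noteq> Minf) \<and>
     (\<forall>x. v x = Pinf \<longleftrightarrow> x = 0) \<and>
     (\<forall>x y. v (x * y) = v x + v y) \<and>
     (\<forall>x y. min (v x) (v y) \<le> v (x + y))"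

definition valuation_ring :: "('a::field \<Rightarrow> 'g::linordered_ab_group_add extended) \<Rightarrow> 'a set" where
  "valuation_ring v = {x. 0 \<le> v x}"

definition value_group :: "('a::field \<Rightarrow> 'g::linordered_ab_group_add extended) \<Rightarrow> 'g set" where
  "value_group v = {g. \<exists>x. v x = Fin g}"


text \<open>The rational function field \<open>K(X)\<close> is the type \<open>'a poly fract\<close>.\<close>

definition rat_const :: "'a::field \<Rightarrow> 'a poly fract" where
  "rat_const a = to_fract [:a:]"

definition rat_X :: "'a::field poly fract" where
  "rat_X = to_fract [:0, 1:]"

definition extends_valuation ::
  "('a::field \<Rightarrow> 'g::linordered_ab_group_add extended) \<Rightarrow> ('a poly fract \<Rightarrow> 'g extended) \<Rightarrow> bool" where
  "extends_valuation v w \<longleftrightarrow> (\<forall>a. w (rat_const a) = v a)"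

definition rat_defined_at :: "'a::field poly fract \<Rightarrow> 'a \<Rightarrow> bool" where
  "rat_defined_at \<phi> x \<longleftrightarrow> (\<exists>p q. \<phi> = Fraction_Field.Fract p q \<and> poly q x \<noteq> 0)"

definition rat_eval :: "'a::field poly fract \<Rightarrow> 'a \<Rightarrow> 'a" where
  "rat_eval \<phi> x =
     (THE y. \<exists>p q. \<phi> = Fraction_Field.Fract p q \<and> poly q x \<noteq> 0 \<and> y = poly p x / poly q x)"

lemma rat_eval_Fract:
  assumes "poly q x \<noteq> 0"
  shows "rat_eval (Fraction_Field.Fract p q) x = poly p x / poly q x"
  unfolding rat_eval_def
proof (rule the_equality)
  show "\<exists>p' q'. Fraction_Field.Fract p q = Fraction_Field.Fract p' q' \<and> poly q' x \<noteq> 0 \<and>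
          poly p x / poly q x = poly p' x / poly q' x"
    using assms by blast
next
  fix y
  assume "\<exists>p' q'. Fraction_Field.Fract p q = Fraction_Field.Fract p' q' \<and> poly q' x \<noteq> 0 \<and>
            y = poly p' x / poly q' x"
  then obtain p' q' where eq: "Fraction_Field.Fract p q = Fraction_Field.Fract p' q'"
    and q': "poly q' x \<noteq> 0" and y: "y = poly p' x / poly q' x" by blast
  have "q \<noteq> 0" "q' \<noteq> 0" using assms q' by auto
  with eq have "p * q' = p' * q" by (simp add: eq_fract)
  then have "poly (p * q') x = poly (p' * q) x" by simp
  then have "poly p x * poly q' x = poly p' x * poly q x" by simp
  with y assms q' show "y = poly p x / poly q x" by (simp add: frac_eq_eq)
qed


text \<open>The tensor product of abelian groups over the integers: the free abelian group on
  \<open>A \<times> B\<close> modulo the bilinearity relations.\<close>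

definition tensor_relations :: "('a, 'm) monoid_scheme \<Rightarrow> ('b, 'n) monoid_scheme \<Rightarrow> ('a \<times> 'b \<Rightarrow>\<^sub>0 int) set" where
  "tensor_relations A B =
     {frag_of (a \<otimes>\<^bsub>A\<^esub> a', b) - frag_of (a, b) - frag_of (a', b) | a a' b.
        a \<in> carrier A \<and> a' \<in> carrier A \<and> b \<in> carrier B} \<union>
     {frag_of (a, b \<otimes>\<^bsub>B\<^esub> b') - frag_of (a, b) - frag_of (a, b') | a b b'.
        a \<in> carrier A \<and> b \<in> carrier B \<and> b' \<in> carrier B}"

definition tensor_kernel :: "('a, 'm) monoid_scheme \<Rightarrow> ('b, 'n) monoid_scheme \<Rightarrow> ('a \<times> 'b \<Rightarrow>\<^sub>0 int) set" where
  "tensor_kernel A B =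
     generate (free_Abelian_group (carrier A \<times> carrier B)) (tensor_relations A B)"

definition tensor_group ::
  "('a, 'm) monoid_scheme \<Rightarrow> ('b, 'n) monoid_scheme \<Rightarrow> ('a \<times> 'b \<Rightarrow>\<^sub>0 int) set monoid" where
  "tensor_group A B = free_Abelian_group (carrier A \<times> carrier B) Mod tensor_kernel A B"

definition rat_group :: "rat monoid" where
  "rat_group = \<lparr>carrier = UNIV, monoid.mult = (+), one = 0\<rparr>"

text \<open>\<open>q \<cdot> (r \<otimes> b) = q r \<otimes> b\<close> on representatives\<close>

definition rat_scale :: "rat \<Rightarrow> (rat \<times> 'b \<Rightarrow>\<^sub>0 int) \<Rightarrow> (rat \<times> 'b \<Rightarrow>\<^sub>0 int)" where
  "rat_scale q = frag_extend (\<lambda>(r, b). frag_of (q * r, b))"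

text \<open>The rational vector space \<open>\<rat> \<otimes> B\<close>. A vector is a coset \<open>C\<close> of the kernel, and all the
  \<open>rat_scale q x\<close> with \<open>x \<in> C\<close> lie in the same coset. The record fields \<open>mult\<close> and \<open>one\<close>, inherited
  from the record of rings, have no meaning for modules.\<close>

definition rat_tensor :: "('b, 'n) monoid_scheme \<Rightarrow> (rat, (rat \<times> 'b \<Rightarrow>\<^sub>0 int) set) module" where
  "rat_tensor B =
     \<lparr>carrier = carrier (tensor_group rat_group B),
      monoid.mult = undefined, one = undefined,
      zero = \<one>\<^bsub>tensor_group rat_group B\<^esub>,
      add = (\<otimes>\<^bsub>tensor_group rat_group B\<^esub>),
      smult = (\<lambda>q C. \<Union>x\<in>C. tensor_kernel rat_group B
                 #>\<^bsub>free_Abelian_group (carrier rat_group \<times> carrier B)\<^esub> rat_scale q x)\<rparr>"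

text \<open>\<open>vectorspace.dim\<close> is meaningless without \<open>vectorspace.fin_dim\<close>.\<close>

definition value_transcendental ::
  "('a::field \<Rightarrow> 'g::linordered_ab_group_add extended) \<Rightarrow> ('a poly fract \<Rightarrow> 'g extended) \<Rightarrow> bool" where
  "value_transcendental v w \<longleftrightarrow>
     (let Q = \<lparr>carrier = value_group w, monoid.mult = (+), one = 0\<rparr> Mod value_group v;
          V = rat_tensor Q
      in vectorspace.fin_dim class_ring V \<and> vectorspace.dim class_ring V = 1)"


text \<open>A sequence indexed by a limit ordinal is a function on a well-ordered type without
  largest element.\<close>

definition pseudo_divergent ::
  "('a::field \<Rightarrow> 'g::linordered_ab_group_add extended) \<Rightarrow> ('i::{wellorder,no_top} \<Rightarrow> 'a) \<Rightarrow> bool" where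
  "pseudo_divergent v z \<longleftrightarrow>
     (\<forall>\<nu>1 \<nu>2 \<nu>3. \<nu>1 < \<nu>2 \<longrightarrow> \<nu>2 < \<nu>3 \<longrightarrow> v (z \<nu>1 - z \<nu>2) > v (z \<nu>2 - z \<nu>3))"

text \<open>Meaningful only for \<open>\<nu>\<close> different from the least index.\<close>

definition pds_gauge ::
  "('a::field \<Rightarrow> 'g::linordered_ab_group_add extended) \<Rightarrow> ('i::{wellorder,no_top} \<Rightarrow> 'a) \<Rightarrow> 'i \<Rightarrow> 'g extended" where
  "pds_gauge v z \<nu> = (THE d. \<forall>\<mu><\<nu>. v (z \<nu> - z \<mu>) = d)"

definition diverges_to_infinity ::
  "('a::field \<Rightarrow> 'g::linordered_ab_group_add extended) \<Rightarrow> ('i::{wellorder,no_top} \<Rightarrow> 'a) \<Rightarrow> bool" where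
  "diverges_to_infinity v z \<longleftrightarrow>
     (\<forall>\<gamma>\<in>value_group v. \<exists>\<nu>. (\<exists>\<mu>. \<mu> < \<nu>) \<and> pds_gauge v z \<nu> \<le> Fin \<gamma>)"

definition pds_limit ::
  "('a::field \<Rightarrow> 'g::linordered_ab_group_add extended) \<Rightarrow> ('a poly fract \<Rightarrow> 'g extended) \<Rightarrow>
   ('i::{wellorder,no_top} \<Rightarrow> 'a) \<Rightarrow> 'a poly fract \<Rightarrow> bool" where
  "pds_limit v w z y \<longleftrightarrow> (\<forall>\<^sub>F \<nu> in at_top. w (y - rat_const (z \<nu>)) = pds_gauge v z \<nu>)"

text \<open>The valuation ring of \<open>v\<^sub>E\<close>. The terms of a pseudo divergent sequence are pairwise distinct,
  except possibly the first two, so every rational function is defined at all but finitely many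
  of them.\<close>

definition pds_valuation_ring ::
  "('a::field \<Rightarrow> 'g::linordered_ab_group_add extended) \<Rightarrow> ('i::{wellorder,no_top} \<Rightarrow> 'a) \<Rightarrow> 'a poly fract set" where
  "pds_valuation_ring v z =
     {\<phi>. \<forall>\<^sub>F \<nu> in at_top. rat_defined_at \<phi> (z \<nu>) \<and> 0 \<le> v (rat_eval \<phi> (z \<nu>))}"


subsection \<open>Well-definedness\<close>

lemma is_valuation_uminus:
  assumes "is_valuation v"
  shows "v (- x) = v x"
proof -
  have mult: "v (a * b) = v a + v b" for a b
    using assms unfolding is_valuation_def by blast
  have one: "v 1 = 0"
  proof -
    have "v 1 = v 1 + v 1" using mult[of 1 1] by simp
    moreover have "v 1 \<noteq> Minf" "v 1 \<noteq> Pinf" using assms unfolding is_valuation_def by auto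
    ultimately show ?thesis by (cases "v 1") (auto simp: zero_extended_def)
  qed
  have "v (- 1) + v (- 1) = 0" using mult[of "- 1" "- 1"] one by simp
  then have m1: "v (- 1) = 0"
    by (cases "v (- 1)") (auto simp: zero_extended_def)
  show ?thesis using mult[of "- 1" x] m1 by simp
qed

lemma is_valuation_add_less:
  assumes "is_valuation v" "v x < v y"
  shows "v (x + y) = v x"
proof (rule antisym)
  have *: "min (v a) (v b) \<le> v (a + b)" for a b
    using assms(1) unfolding is_valuation_def by blast
  show "v x \<le> v (x + y)" using *[of x y] assms(2) by (simp add: min.absorb1)
  have "min (v (x + y)) (v y) \<le> v x"
    using *[of "x + y" "- y"] is_valuation_uminus[OF assms(1)] by simp
  then show "v (x + y) \<le> v x" using assms(2) by (auto simp: min_def split: if_splits)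
qed

lemma pds_gauge_eq:
  assumes v: "is_valuation v" and z: "pseudo_divergent v z" and "\<mu> < \<nu>"
  shows "pds_gauge v z \<nu> = v (z \<nu> - z \<mu>)"
proof -
  have gt: "v (z a - z b) = v (z a - z c)" if "c < b" "b < a" for a b c
  proof -
    have "v (z c - z b) > v (z b - z a)" using z that unfolding pseudo_divergent_def by blast
    then have "v (z a - z b) < v (z b - z c)"
      using is_valuation_uminus[OF v, of "z a - z b"] is_valuation_uminus[OF v, of "z b - z c"]
      by simp
    from is_valuation_add_less[OF v this] show ?thesis by simp
  qed
  have "v (z \<nu> - z \<mu>') = v (z \<nu> - z \<mu>)" if "\<mu>' < \<nu>" for \<mu>'
    using linorder_less_linear[of \<mu>' \<mu>] gt[of \<mu>' \<mu> \<nu>] gt[of \<mu> \<mu>' \<nu>] that \<open>\<mu> < \<nu>\<close> by auto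
  then show ?thesis unfolding pds_gauge_def using \<open>\<mu> < \<nu>\<close> by (intro the_equality) blast+
qed

lemma vectorspace_rat_tensor:
  assumes B: "comm_group B"
  shows "vectorspace class_ring (rat_tensor B)"
proof -
  define F where "F = free_Abelian_group (carrier rat_group \<times> carrier B)"
  define N where "N = tensor_kernel rat_group B"
  interpret B: comm_group B by (rule B)
  interpret F: comm_group F unfolding F_def by (rule abelian_free_Abelian_group)
  have cR [simp]: "carrier rat_group = UNIV" by (simp add: rat_group_def)
  have mR [simp]: "a \<otimes>\<^bsub>rat_group\<^esub> b = a + b" for a b by (simp add: rat_group_def)
  have multF [simp]: "x \<otimes>\<^bsub>F\<^esub> y = x + y" for x y by (simp add: F_def)
  have carF: "x \<in> carrier F \<longleftrightarrow> Poly_Mapping.keys x \<subseteq> UNIV \<times> carrier B" for x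
    by (simp add: F_def)
  have genF: "frag_of (r, b) \<in> carrier F" if "b \<in> carrier B" for r b
    using that by (simp add: F_def)
  have diffF: "x - y \<in> carrier F" if "x \<in> carrier F" "y \<in> carrier F" for x y
    using that keys_diff[of x y] unfolding carF by blast
  have addF: "x + y \<in> carrier F" if "x \<in> carrier F" "y \<in> carrier F" for x y
    using F.m_closed[OF that] by simp
  have rels: "tensor_relations rat_group B \<subseteq> carrier F"
    unfolding tensor_relations_def by (auto intro!: diffF genF)
  have N: "subgroup N F"
    unfolding N_def tensor_kernel_def F_def[symmetric] by (rule F.generate_is_subgroup[OF rels])
  have normN: "N \<lhd> F" using N by (simp add: F.normal_iff_subgroup)
  interpret N: normal N F by (rule normN)
  define T where "T = tensor_group rat_group B"
  have T: "T = F Mod N" by (simp add: T_def tensor_group_def F_def N_def)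
  interpret T: comm_group T unfolding T by (rule F.abelian_FactGroup[OF N])
  have carT: "carrier T = (\<lambda>x. N #>\<^bsub>F\<^esub> x) ` carrier F"
    by (simp add: T carrier_FactGroup)
  have sumT: "(N #>\<^bsub>F\<^esub> x) \<otimes>\<^bsub>T\<^esub> (N #>\<^bsub>F\<^esub> y) = N #>\<^bsub>F\<^esub> (x + y)"
    if "x \<in> carrier F" "y \<in> carrier F" for x y
    using that by (simp add: T N.rcos_sum)
  have invF: "inv\<^bsub>F\<^esub> x = - x" if "x \<in> carrier F" for x
    using that unfolding F_def by simp
  have ND: "x - y \<in> N" if "x \<in> N" "y \<in> N" for x y
    using N.m_closed[OF that(1) N.m_inv_closed[OF that(2)]] invF[of y] that(2) N.mem_carrier by auto
  have N0: "0 \<in> N" using N.one_closed by (simp add: F_def)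
  have eqN: "N #>\<^bsub>F\<^esub> x = N #>\<^bsub>F\<^esub> y" if "x \<in> carrier F" "y \<in> carrier F" "x - y \<in> N" for x y
  proof -
    have "x \<in> N #>\<^bsub>F\<^esub> y" using that(3) unfolding r_coset_def by force
    from F.repr_independence[OF this that(2) N] show ?thesis by simp
  qed
  have genN: "x \<in> N" if "x \<in> tensor_relations rat_group B" for x
    using that unfolding N_def tensor_kernel_def by (rule generate.incl)

  have s_of [simp]: "rat_scale q (frag_of (r, b)) = frag_of (q * r, b)" for q r b
    by (simp add: rat_scale_def)
  have s_add: "rat_scale q (x + y) = rat_scale q x + rat_scale q y" for q x y
    by (simp add: rat_scale_def frag_extend_add)
  have s_diff: "rat_scale q (x - y) = rat_scale q x - rat_scale q y" for q x y
    by (simp add: rat_scale_def frag_extend_diff)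
  have s_0 [simp]: "rat_scale q 0 = 0" for q by (simp add: rat_scale_def)
  have induct: "P x" if "x \<in> carrier F" "P 0"
      "\<And>x y. x \<in> carrier F \<Longrightarrow> y \<in> carrier F \<Longrightarrow> P x \<Longrightarrow> P y \<Longrightarrow> P (x - y)"
      "\<And>r b. b \<in> carrier B \<Longrightarrow> P (frag_of (r, b))" for P x
    by (rule free_Abelian_group_induct[of x "UNIV \<times> carrier B" P])
       (use that carF in auto)
  have s_F: "rat_scale q x \<in> carrier F" if "x \<in> carrier F" for q x
    by (rule induct[of _ "\<lambda>x. rat_scale q x \<in> carrier F", OF that])
       (auto simp: s_diff carF[of 0] intro: diffF genF)
  have s_rel: "rat_scale q x \<in> tensor_relations rat_group B"
    if "x \<in> tensor_relations rat_group B" for q x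
    using that unfolding tensor_relations_def
    by (fastforce simp: s_diff distrib_left)
  have s_N: "rat_scale q x \<in> N" if "x \<in> N" for q x
    using that unfolding N_def tensor_kernel_def F_def[symmetric]
  proof (induct rule: generate.induct)
    case one
    then show ?case using generate.one[of F] by (simp add: F_def)
  next
    case (incl h)
    then show ?case using s_rel generate.incl by metis
  next
    case (inv h)
    have "rat_scale q (inv\<^bsub>F\<^esub> h) = inv\<^bsub>F\<^esub> (rat_scale q h)"
      using inv rels s_F[of h q] s_diff[of q 0 h] by (auto simp: invF subset_iff)
    then show ?case using s_rel[OF inv] generate.inv by metis
  next
    case (eng h1 h2)
    then show ?case using generate.eng[of "rat_scale q h1" F _ "rat_scale q h2"] by (simp add: s_add)
  qed
  have s_plus: "rat_scale (q + r) x - (rat_scale q x + rat_scale r x) \<in> N" if "x \<in> carrier F" for q r x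
    using that
  proof (rule induct[of _ "\<lambda>x. rat_scale (q + r) x - (rat_scale q x + rat_scale r x) \<in> N"], goal_cases)
    case 1
    then show ?case by (simp add: N0)
  next
    case (2 x y)
    from ND[OF 2(3) 2(4)] show ?case by (simp add: s_diff algebra_simps)
  next
    case (3 s b)
    then have "frag_of (q * s + r * s, b) - frag_of (q * s, b) - frag_of (r * s, b)
        \<in> tensor_relations rat_group B"
      unfolding tensor_relations_def by force
    from genN[OF this] show ?case by (simp add: distrib_right diff_diff_eq)
  qed
  have s_plus': "N #>\<^bsub>F\<^esub> rat_scale (q + r) x = N #>\<^bsub>F\<^esub> (rat_scale q x + rat_scale r x)"
    if "x \<in> carrier F" for q r x
    using that by (intro eqN s_plus s_F addF)
  have s_mult: "rat_scale (q * r) x = rat_scale q (rat_scale r x)" if "x \<in> carrier F" for q r x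
    by (rule induct[of _ "\<lambda>x. rat_scale (q * r) x = rat_scale q (rat_scale r x)", OF that])
       (auto simp: s_diff mult.assoc)
  have s_one: "rat_scale 1 x = x" if "x \<in> carrier F" for x
    by (rule induct[of _ "\<lambda>x. rat_scale 1 x = x", OF that]) (auto simp: s_diff)

  define V where "V = rat_tensor B"
  have V: "carrier V = carrier T" "zero V = \<one>\<^bsub>T\<^esub>" "add V = (\<otimes>\<^bsub>T\<^esub>)"
    by (simp_all add: V_def rat_tensor_def T_def)
  have sm: "q \<odot>\<^bsub>V\<^esub> (N #>\<^bsub>F\<^esub> x) = N #>\<^bsub>F\<^esub> rat_scale q x" if x: "x \<in> carrier F" for q x
  proof -
    have "q \<odot>\<^bsub>V\<^esub> (N #>\<^bsub>F\<^esub> x) = (\<Union>y\<in>N #>\<^bsub>F\<^esub> x. N #>\<^bsub>F\<^esub> rat_scale q y)"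
      by (simp add: V_def rat_tensor_def F_def N_def)
    also have "\<dots> = (\<Union>y\<in>N #>\<^bsub>F\<^esub> x. N #>\<^bsub>F\<^esub> rat_scale q x)"
    proof (rule SUP_cong[OF refl])
      fix y assume y: "y \<in> N #>\<^bsub>F\<^esub> x"
      then obtain n where n: "n \<in> N" "y = n + x" unfolding r_coset_def by auto
      have "y \<in> carrier F" using n x N.mem_carrier addF by blast
      then show "N #>\<^bsub>F\<^esub> rat_scale q y = N #>\<^bsub>F\<^esub> rat_scale q x"
        using n x s_N[OF n(1)] by (intro eqN s_F) (auto simp: s_add)
    qed
    also have "\<dots> = N #>\<^bsub>F\<^esub> rat_scale q x"
      using F.rcos_self[OF x N] by auto
    finally show ?thesis .
  qed
  have ab: "abelian_group V"
  proof (rule abelian_groupI)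
    fix x assume "x \<in> carrier V"
    then show "\<exists>y\<in>carrier V. y \<oplus>\<^bsub>V\<^esub> x = \<zero>\<^bsub>V\<^esub>" using T.l_inv_ex by (auto simp: V)
  qed (simp_all add: V T.m_ac)
  have "module (class_ring :: rat ring) V"
  proof (rule moduleI)
    show "cring (class_ring :: rat ring)" by (rule class_cring.is_cring)
    show "abelian_group V" by (rule ab)
  qed (auto simp: V carT sm sumT s_F addF s_add s_plus' s_mult s_one)
  then show ?thesis
    unfolding V_def[symmetric] by (intro vectorspace.intro class_field)
qed

lemma value_group_closed:
  assumes v: "is_valuation v"
  shows "0 \<in> value_group v"
    and "g \<in> value_group v \<Longrightarrow> h \<in> value_group v \<Longrightarrow> g + h \<in> value_group v"
    and "g \<in> value_group v \<Longrightarrow> - g \<in> value_group v"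
proof -
  have mult: "v (a * b) = v a + v b" for a b
    using v unfolding is_valuation_def by blast
  have fin: "\<exists>k. v x = Fin k" if "x \<noteq> 0" for x
    using v that unfolding is_valuation_def by (cases "v x") auto
  obtain e where e: "v 1 = Fin e" using fin[of 1] by auto
  have "Fin e + Fin e = Fin e" using mult[of 1 1] e by simp
  then have one: "v 1 = Fin 0" using e by simp
  then show "0 \<in> value_group v" unfolding value_group_def by blast
  show "g + h \<in> value_group v" if gh: "g \<in> value_group v" "h \<in> value_group v"
  proof -
    obtain x y where "v x = Fin g" "v y = Fin h" using gh unfolding value_group_def by blast
    then have "v (x * y) = Fin (g + h)" using mult[of x y] by simp
    then show ?thesis unfolding value_group_def by blast
  qed
  show "- g \<in> value_group v" if g: "g \<in> value_group v"
  proof -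
    obtain x where x: "v x = Fin g" using g unfolding value_group_def by blast
    have "v 0 = Pinf" using v unfolding is_valuation_def by blast
    with x have "x \<noteq> 0" by auto
    moreover obtain k where k: "v (inverse x) = Fin k" using fin[of "inverse x"] \<open>x \<noteq> 0\<close> by auto
    ultimately have "Fin g + Fin k = Fin 0" using mult[of x "inverse x"] x one by simp
    then have "k = - g" by (simp add: eq_neg_iff_add_eq_0 add.commute)
    then show ?thesis using k unfolding value_group_def by blast
  qed
qed

lemma vectorspace_value_quotient:
  assumes v: "is_valuation v" and w: "is_valuation w" and ext: "extends_valuation v w"
  shows "vectorspace class_ring
           (rat_tensor (\<lparr>carrier = value_group w, monoid.mult = (+), one = 0\<rparr> Mod value_group v))"
proof -
  let ?G = "\<lparr>carrier = value_group w, monoid.mult = (+), one = 0\<rparr>"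
  have sub: "value_group v \<subseteq> value_group w"
    using ext unfolding value_group_def extends_valuation_def by auto metis
  have inv_ex: "\<exists>h\<in>value_group w. g + h = 0" if "g \<in> value_group w" for g
    using value_group_closed(3)[OF w that] by (rule rev_bexI) simp
  interpret G: comm_group ?G
    by (rule comm_groupI) (auto simp: value_group_closed[OF w] algebra_simps inv_ex)
  have inv: "inv\<^bsub>?G\<^esub> g = - g" if "g \<in> value_group v" for g
    using that sub value_group_closed(3)[OF w] by (intro G.inv_equality) auto
  have "subgroup (value_group v) ?G"
    using sub value_group_closed[OF v] by (intro subgroup.intro) (auto simp: inv)
  then show ?thesis by (intro vectorspace_rat_tensor G.abelian_FactGroup)
qed

end

theory Submission
  imports Defs
begin

text \<open>If \<open>X\<close> is not a limit of \<open>E\<close>, then \<open>w X < vK\<close>: otherwise \<open>v z\<^sub>\<nu> = \<delta>\<^sub>\<nu> < w X\<close> for all large \<open>\<nu>\<close>,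
  and hence \<open>w (X - z\<^sub>\<nu>) = \<delta>\<^sub>\<nu>\<close>. So both \<open>X\<close>, with respect to \<open>w\<close>, and \<open>z\<^sub>\<nu>\<close> for large \<open>\<nu>\<close>, with
  respect to \<open>v\<close>, have values below any prescribed element of \<open>vK\<close>. At such an element the value of
  a polynomial is that of its leading term, so whether a fraction has nonnegative value is in both
  cases decided by the degrees and leading coefficients of numerator and denominator.\<close>

section \<open>Cancellation and comparison rules for a single valuation\<close>

context
  fixes u :: "'b::field \<Rightarrow> 'g::linordered_ab_group_add extended"
  assumes u: "is_valuation u"
begin

lemma valuation_mult: "u (x * y) = u x + u y"
  using u unfolding is_valuation_def by blast

lemma valuation_eq_Pinf_iff: "u x = Pinf \<longleftrightarrow> x = 0"
  using u unfolding is_valuation_def by blast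

lemma valuation_finite:
  assumes "x \<noteq> 0"
  obtains g where "u x = Fin g"
  using assms u unfolding is_valuation_def by (cases "u x") auto

lemma valuation_0: "u 0 = Pinf"
  by (simp add: valuation_eq_Pinf_iff)

lemma valuation_1: "u 1 = 0"
  using valuation_mult[of 1 1] by (rule_tac valuation_finite[of 1]) (auto simp: zero_extended_def)

lemma valuation_minus_commute: "u (x - y) = u (y - x)"
  using is_valuation_uminus[OF u, of "x - y"] by simp

lemma valuation_diff_less:
  assumes "u x < u y"
  shows "u (x - y) = u x"
  using is_valuation_add_less[OF u, of x "- y"] is_valuation_uminus[OF u] assms by simp

lemma valuation_mult_le_cancel:
  assumes "z \<noteq> 0"
  shows "u (x * z) \<le> u (y * z) \<longleftrightarrow> u x \<le> u y"
proof -
  obtain g where g: "u z = Fin g" using valuation_finite[OF assms] .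
  show ?thesis by (cases "u x"; cases "u y") (simp_all add: valuation_mult g)
qed

lemma valuation_mult_less_cancel:
  assumes "z \<noteq> 0"
  shows "u (x * z) < u (y * z) \<longleftrightarrow> u x < u y"
  using valuation_mult_le_cancel[OF assms, of y x] by (simp add: not_le[symmetric])

lemma valuation_less_iff_divide:
  assumes "z \<noteq> 0"
  shows "u (x * z) < u y \<longleftrightarrow> u x < u (y / z)"
  using valuation_mult_less_cancel[OF assms, of x "y / z"] assms by simp

lemma valuation_divide_nonneg_iff:
  assumes "z \<noteq> 0"
  shows "0 \<le> u (y / z) \<longleftrightarrow> u z \<le> u y"
  using valuation_mult_le_cancel[OF assms, of 1 "y / z"] assms by (simp add: valuation_1)

text \<open>Multiplying by \<open>x\<close> preserves inequalities of values, and \<open>u x\<close>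
  lies below \<open>u 1\<close>. The bound reduces powers of any positive degree to degree
  one.\<close>

lemma valuation_power_Suc_le:
  assumes "u x < 0"
  shows "u (x ^ Suc n) \<le> u x"
proof (induction n)
  case (Suc n)
  have "x \<noteq> 0" using assms by (auto simp: valuation_0 zero_extended_def)
  then have "u (x ^ Suc n * x) \<le> u (1 * x)"
    using Suc assms by (subst valuation_mult_le_cancel) (auto simp: valuation_1)
  then show ?case by (simp add: mult.commute)
qed simp

end

section \<open>Polynomials at points of arbitrarily low value\<close>

text \<open>\<open>e i\<close> is evaluation at \<open>x i\<close>. Of the embedding \<open>c\<close> of the constants, only the compatibility
  with the valuations matters.\<close>

context
  fixes v :: "'a::field \<Rightarrow> 'g::linordered_ab_group_add extended"
    and u :: "'b::field \<Rightarrow> 'g extended"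
    and c :: "'a \<Rightarrow> 'b" and x :: "'i \<Rightarrow> 'b" and e :: "'i \<Rightarrow> 'a poly \<Rightarrow> 'b" and F :: "'i filter"
  assumes v: "is_valuation v" and u: "is_valuation u"
    and c: "\<And>a. u (c a) = v a"
    and e_0: "\<And>i. e i 0 = 0"
    and e_pCons: "\<And>i a p. e i (pCons a p) = c a + x i * e i p"
    and small: "\<And>s. s \<noteq> 0 \<Longrightarrow> \<forall>\<^sub>F i in F. u (x i) < v s"
begin

lemma const_eq_0_iff: "c a = 0 \<longleftrightarrow> a = 0"
  using valuation_eq_Pinf_iff[OF u, of "c a"] valuation_eq_Pinf_iff[OF v, of a] by (simp add: c)

text \<open>\<open>small\<close> is used twice: at 1, so that positive powers of \<open>x i\<close>
  have value at most \<open>u (x i)\<close>, and at \<open>a / b\<close>, to absorb the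
  coefficient.\<close>

lemma eventually_monomial_less_const:
  assumes "b \<noteq> 0" "a \<noteq> 0"
  shows "\<forall>\<^sub>F i in F. u (c b * x i ^ Suc n) < v a"
proof -
  have b: "c b \<noteq> 0" using assms(1) by (simp add: const_eq_0_iff)
  \<comment> \<open>\<open>c\<close> is only known to preserve values, so \<open>c a / c b\<close>
    cannot simply be rewritten as \<open>c (a / b)\<close>. Adding \<open>v b\<close> turns both
    values into \<open>v a\<close>, and finite summands cancel.\<close>
  have vab: "u (c a / c b) = v (a / b)"
  proof -
    obtain g h k l where "v b = Fin g" "v (a / b) = Fin h" "u (c a / c b) = Fin k"
      using assms b by (metis valuation_finite[OF v] valuation_finite[OF u] const_eq_0_iff divide_eq_0_iff)
    moreover have "v (a / b) + v b = v a"
      using assms by (simp flip: valuation_mult[OF v])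
    moreover have "u (c a / c b) + u (c b) = v a"
      using b by (simp add: c[symmetric] flip: valuation_mult[OF u])
    ultimately have "Fin (h + g) = Fin (k + g)" by (simp add: c)
    then show ?thesis using \<open>v (a / b) = Fin h\<close> \<open>u (c a / c b) = Fin k\<close> by simp
  qed
  have "\<forall>\<^sub>F i in F. u (x i) < v 1" "\<forall>\<^sub>F i in F. u (x i) < v (a / b)"
    using assms by (auto intro!: small)
  then show ?thesis
  proof eventually_elim
    case (elim i)
    have "u (x i ^ Suc n) \<le> u (x i)"
      using valuation_power_Suc_le[OF u] elim(1) by (simp add: valuation_1[OF v])
    also have "\<dots> < u (c a / c b)" using elim(2) by (simp add: vab)
    finally have "u (x i ^ Suc n * c b) < u (c a)"
      by (subst valuation_less_iff_divide[OF u b])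
    then show ?case by (simp only: c mult.commute)
  qed
qed

lemma eventually_nonzero: "\<forall>\<^sub>F i in F. x i \<noteq> 0"
  using small[OF one_neq_zero] by eventually_elim (auto simp: valuation_0[OF u])

text \<open>Induction along Horner's scheme: the value of \<open>x i * e i q\<close> is that of the
  leading monomial, which eventually lies strictly below \<open>v a\<close>; in a sum of two terms
  of different value the smaller value wins.\<close>

lemma eventually_valuation_eq_leading_term:
  assumes "p \<noteq> 0"
  shows "\<forall>\<^sub>F i in F. u (e i p) = u (c (lead_coeff p) * x i ^ degree p)"
  using assms
proof (induction p)
  case (pCons a q)
  show ?case
  proof (cases "q = 0")
    case True
    then show ?thesis by (simp add: e_pCons e_0)
  next
    case False
    then have l: "lead_coeff q \<noteq> 0" by simp
    have less: "\<forall>\<^sub>F i in F. u (c (lead_coeff q) * x i ^ Suc (degree q)) < v a"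
    \<comment> \<open>\<open>small\<close> says nothing about \<open>a = 0\<close>. There
      \<open>v a\<close> is \<open>Pinf\<close>, and the monomial only has to be nonzero.\<close>
    proof (cases "a = 0")
      case True
      from eventually_nonzero show ?thesis
      proof eventually_elim
        case (elim i)
        then have "c (lead_coeff q) * x i ^ Suc (degree q) \<noteq> 0"
          using l by (simp add: const_eq_0_iff)
        then show ?case
          by (rule valuation_finite[OF u]) (simp add: True valuation_0[OF v])
      qed
    qed (rule eventually_monomial_less_const[OF l])
    from less pCons.IH[OF False] show ?thesis
    proof eventually_elim
      case (elim i)
      have eq: "u (x i * e i q) = u (c (lead_coeff q) * x i ^ Suc (degree q))"
        using elim(2) by (simp add: valuation_mult[OF u] ac_simps)
      then have "u (x i * e i q) < u (c a)" using elim(1) by (simp add: c)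
      from is_valuation_add_less[OF u this] show ?case
        using False by (simp add: e_pCons eq add.commute)
    qed
  qed
qed simp

text \<open>The leading monomial is nonzero, so its value, shared by \<open>e i p\<close>, is not
  \<open>Pinf\<close>.\<close>

lemma eventually_eval_nonzero:
  assumes "p \<noteq> 0"
  shows "\<forall>\<^sub>F i in F. e i p \<noteq> 0"
  using eventually_valuation_eq_leading_term[OF assms] eventually_nonzero
proof eventually_elim
  case (elim i)
  have "c (lead_coeff p) * x i ^ degree p \<noteq> 0"
    using elim(2) assms by (simp add: const_eq_0_iff)
  then show ?case
    using elim(1) valuation_eq_Pinf_iff[OF u] by metis
qed

text \<open>The criterion on the right mentions none of \<open>u\<close>, \<open>x\<close>,
  \<open>e\<close>, \<open>F\<close>. Hence evaluation at \<open>X\<close> and evaluation along the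
  sequence, both over the same \<open>v\<close>, obey one and the same criterion.\<close>

lemma eventually_quotient_integral_iff:
  assumes "q \<noteq> 0"
  shows "\<forall>\<^sub>F i in F. 0 \<le> u (e i p / e i q) \<longleftrightarrow>
           p = 0 \<or> degree p < degree q \<or>
           degree p = degree q \<and> v (lead_coeff q) \<le> v (lead_coeff p)"
proof (cases "p = 0")
  case True
  then show ?thesis by (simp add: e_0 valuation_0[OF u] zero_extended_def)
next
  case False
  let ?t = "\<lambda>p i. c (lead_coeff p) * x i ^ degree p"
  \<comment> \<open>Cancelling the common power of \<open>x i\<close> leaves a monomial of positive
    degree against a constant.\<close>
  have dominated: "\<forall>\<^sub>F i in F. u (?t r i) < u (?t s i)"
    if "degree s < degree r" "r \<noteq> 0" "s \<noteq> 0" for r s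
  proof -
    obtain k where k: "degree r = Suc k + degree s"
      using \<open>degree s < degree r\<close> by (metis add.commute add_Suc_right less_imp_Suc_add)
    have "\<forall>\<^sub>F i in F. u (c (lead_coeff r) * x i ^ Suc k) < v (lead_coeff s)"
      using that by (intro eventually_monomial_less_const) auto
    from this eventually_nonzero show ?thesis
    proof eventually_elim
      case (elim i)
      then have "u (c (lead_coeff r) * x i ^ Suc k * x i ^ degree s)
          < u (c (lead_coeff s) * x i ^ degree s)"
        by (subst valuation_mult_less_cancel[OF u]) (simp_all add: c)
      then show ?case by (simp only: k power_add mult.assoc)
    qed
  qed
  have "\<forall>\<^sub>F i in F. u (?t q i) \<le> u (?t p i) \<longleftrightarrow>
           degree p < degree q \<or> degree p = degree q \<and> v (lead_coeff q) \<le> v (lead_coeff p)"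
  proof (cases "degree p" "degree q" rule: linorder_cases)
    case less
    from \<open>degree p < degree q\<close> assms False have "\<forall>\<^sub>F i in F. u (?t q i) < u (?t p i)"
      by (rule dominated)
    then show ?thesis by eventually_elim (use \<open>degree p < degree q\<close> in auto)
  next
    case equal
    show ?thesis using eventually_nonzero
      by eventually_elim (simp add: equal valuation_mult_le_cancel[OF u] c)
  next
    case greater
    from \<open>degree q < degree p\<close> False assms have "\<forall>\<^sub>F i in F. u (?t p i) < u (?t q i)"
      by (rule dominated)
    then show ?thesis by eventually_elim (use \<open>degree q < degree p\<close> in auto)
  qed
  from this eventually_eval_nonzero[OF assms] eventually_valuation_eq_leading_term[OF assms]
    eventually_valuation_eq_leading_term[OF False]
  show ?thesis
    by eventually_elim (simp add: False valuation_divide_nonneg_iff[OF u])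
qed

end

section \<open>Low values of the sequence and of the indeterminate\<close>

lemma to_fract_pCons: "to_fract (pCons a p) = rat_const a + rat_X * to_fract p"
proof -
  have "pCons a p = [:a:] + [:0, 1:] * p" by simp
  then show ?thesis unfolding rat_const_def rat_X_def by (metis to_fract_add to_fract_mult)
qed

text \<open>Coinitiality yields one index with gauge at most \<open>v s\<close>. The gauge is
  strictly decreasing, so every later index satisfies the strict bound.\<close>

lemma pseudo_divergent_eventually_less:
  assumes v: "is_valuation v" and z: "pseudo_divergent v z" and "diverges_to_infinity v z"
    and s: "s \<noteq> 0"
  shows "\<forall>\<^sub>F \<nu> in at_top. pds_gauge v z \<nu> < v s"
proof -
  obtain g where g: "v s = Fin g" using valuation_finite[OF v s] .
  then have "g \<in> value_group v" unfolding value_group_def by blast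
  then obtain \<nu> \<mu> where \<mu>: "\<mu> < \<nu>" and le: "pds_gauge v z \<nu> \<le> v s"
    using assms(3) g unfolding diverges_to_infinity_def by metis
  have "pds_gauge v z \<xi> < v s" if \<nu>: "\<nu> < \<xi>" for \<xi>
  proof -
    have "v (z \<nu> - z \<xi>) < v (z \<mu> - z \<nu>)"
      using z \<mu> \<nu> unfolding pseudo_divergent_def by blast
    then have "pds_gauge v z \<xi> < pds_gauge v z \<nu>"
      using pds_gauge_eq[OF v z \<mu>] pds_gauge_eq[OF v z \<nu>]
      by (simp add: valuation_minus_commute[OF v])
    then show ?thesis using le by simp
  qed
  then show ?thesis by (rule eventually_mono[OF eventually_gt_at_top])
qed

text \<open>Compare with a fixed term \<open>z \<mu>\<close>: once the gauge is below
  \<open>v (z \<mu>)\<close>, adding \<open>z \<mu>\<close> to \<open>z \<nu> - z \<mu>\<close> does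
  not change the value.\<close>

lemma pseudo_divergent_eventually_gauge_eq:
  fixes z :: "'i::{wellorder,no_top} \<Rightarrow> 'a::field"
  assumes v: "is_valuation v" and z: "pseudo_divergent v z" and "diverges_to_infinity v z"
  shows "\<forall>\<^sub>F \<nu> in at_top. v (z \<nu>) = pds_gauge v z \<nu>"
proof -
  obtain \<mu> :: 'i where True by simp
  have less: "\<forall>\<^sub>F \<nu> in at_top. pds_gauge v z \<nu> < v (z \<mu>)"
  \<comment> \<open>A zero term has value \<open>Pinf\<close>, so the finite bound
    \<open>v 1\<close> suffices.\<close>
  proof (cases "z \<mu> = 0")
    case True
    have "v 1 < Pinf" by (simp add: valuation_1[OF v] zero_extended_def)
    with pseudo_divergent_eventually_less[OF assms one_neq_zero] show ?thesis
      by (auto simp: True valuation_0[OF v] elim!: eventually_mono)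
  qed (rule pseudo_divergent_eventually_less[OF assms])
  from this eventually_gt_at_top[of \<mu>] show ?thesis
  proof eventually_elim
    case (elim \<nu>)
    then have "v (z \<nu> - z \<mu>) < v (z \<mu>)" using pds_gauge_eq[OF v z] by simp
    from is_valuation_add_less[OF v this] show ?case
      using pds_gauge_eq[OF v z elim(2)] by simp
  qed
qed

lemma value_rat_X_less:
  assumes v: "is_valuation v" and w: "is_valuation w" and ext: "extends_valuation v w"
    and z: "pseudo_divergent v z" "diverges_to_infinity v z"
    and nl: "\<not> pds_limit v w z rat_X" and s: "s \<noteq> 0"
  shows "w rat_X < v s"
proof (rule ccontr)
  assume "\<not> w rat_X < v s"
  then have le: "v s \<le> w rat_X" by simp
  have "\<forall>\<^sub>F \<nu> in at_top. w (rat_X - rat_const (z \<nu>)) = pds_gauge v z \<nu>"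
    using pseudo_divergent_eventually_less[OF v z s] pseudo_divergent_eventually_gauge_eq[OF v z]
  proof eventually_elim
    case (elim \<nu>)
    then have "w (rat_const (z \<nu>)) < w rat_X"
      using ext le unfolding extends_valuation_def by simp
    from valuation_diff_less[OF w this] show ?case
      using ext elim unfolding extends_valuation_def
      by (simp add: valuation_minus_commute[OF w])
  qed
  then show False using nl unfolding pds_limit_def by contradiction
qed

theorem corollary8p2:
  fixes v :: "'a::field \<Rightarrow> 'g::linordered_ab_group_add extended"
    and w :: "'a poly fract \<Rightarrow> 'g extended"
    and z :: "'i::{wellorder,no_top} \<Rightarrow> 'a"
  assumes "is_valuation v"
    and "is_valuation w"
    and "extends_valuation v w"
    and "value_transcendental v w"
    and "pseudo_divergent v z"
    and "diverges_to_infinity v z"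
    and "\<not> pds_limit v w z rat_X"
  shows "valuation_ring w = pds_valuation_ring v z"
proof (rule Set.set_eqI)
  fix \<phi> :: "'a poly fract"
  obtain p q where \<phi>: "\<phi> = Fraction_Field.Fract p q" and q: "q \<noteq> 0"
    by (cases \<phi>) auto
  let ?R = "p = 0 \<or> degree p < degree q \<or>
    degree p = degree q \<and> v (lead_coeff q) \<le> v (lead_coeff p)"
  have small: "\<forall>\<^sub>F \<nu> in at_top. v (z \<nu>) < v s" if "s \<noteq> 0" for s
    using pseudo_divergent_eventually_less[OF assms(1,5,6) that]
      pseudo_divergent_eventually_gauge_eq[OF assms(1,5,6)]
    by eventually_elim simp
  \<comment> \<open>By \<open>to_fract_pCons\<close>, \<open>to_fract\<close> is evaluation at
    \<open>rat_X\<close>; the family of points is constant.\<close>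
  have "\<forall>\<^sub>F i::'i in at_top. 0 \<le> w (to_fract p / to_fract q) \<longleftrightarrow> ?R"
    using assms(3) value_rat_X_less[OF assms(1,2,3,5,6,7)] unfolding extends_valuation_def
    by (intro eventually_quotient_integral_iff[where c = rat_const and x = "\<lambda>_. rat_X"
          and e = "\<lambda>_. to_fract", OF assms(1,2) _ _ _ _ q])
      (simp_all add: to_fract_pCons)
  \<comment> \<open>Nothing here depends on the index and \<open>at_top\<close> is a proper filter,
    so the quantifier drops.\<close>
  then have wR: "0 \<le> w \<phi> \<longleftrightarrow> ?R"
    using q by (simp add: \<phi> Fract_conv_to_fract)
  have "\<forall>\<^sub>F \<nu> in at_top. 0 \<le> v (poly p (z \<nu>) / poly q (z \<nu>)) \<longleftrightarrow> ?R"
    by (rule eventually_quotient_integral_iff[where c = "\<lambda>a. a" and x = z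
          and e = "\<lambda>\<nu> p. poly p (z \<nu>)", OF assms(1,1) _ _ _ small q]) simp_all
  \<comment> \<open>At late terms the single representation \<open>p / q\<close> then serves both
    \<open>rat_defined_at\<close> and \<open>rat_eval\<close>.\<close>
  moreover have "\<forall>\<^sub>F \<nu> in at_top. poly q (z \<nu>) \<noteq> 0"
    by (rule eventually_eval_nonzero[where c = "\<lambda>a. a" and x = z
          and e = "\<lambda>\<nu> p. poly p (z \<nu>)", OF assms(1,1) _ _ _ small q]) simp_all
  ultimately have "\<forall>\<^sub>F \<nu> in at_top.
      (rat_defined_at \<phi> (z \<nu>) \<and> 0 \<le> v (rat_eval \<phi> (z \<nu>))) \<longleftrightarrow> 0 \<le> w \<phi>"
  proof eventually_elim
    case (elim \<nu>)
    then have "rat_defined_at \<phi> (z \<nu>)" unfolding rat_defined_at_def \<phi> by blast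
    then show ?case using elim wR by (simp add: \<phi> rat_eval_Fract)
  qed
  then have "(\<forall>\<^sub>F \<nu> in at_top. rat_defined_at \<phi> (z \<nu>) \<and> 0 \<le> v (rat_eval \<phi> (z \<nu>))) \<longleftrightarrow>
      (\<forall>\<^sub>F \<nu>::'i in at_top. 0 \<le> w \<phi>)"
    by (rule eventually_cong) simp
  then show "\<phi> \<in> valuation_ring w \<longleftrightarrow> \<phi> \<in> pds_valuation_ring v z"
    by (simp add: valuation_ring_def pds_valuation_ring_def)
qed

end
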